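(* Let $d \ge 2$ and let $S = [\mathbf{v}_1, \ldots, \mathbf{v}_{d+1}]$ be a regular $d$-simplex in $\mathbb{R}^d$ having edge length $a$. For every point $\mathbf{t} \in \mathbb{R}^d$, let $t_j = \|\mathbf{t} - \mathbf{v}_j\|$, $1 \le j \le d+1$, be the distances from $\mathbf{t}$ to the vertices of $S$. Let $R = \mathbb{R}[T_1, \ldots, T_{d+1}]$ be the ring of polynomials over $\mathbb{R}$ in the indeterminates $T_1, \ldots, T_{d+1}$, and let $I$ be the ideal of $R$ defined by $$I = \{ f \in R : f(t_1, \ldots, t_{d+1}) = 0 \text{ for all } \mathbf{t} \in \mathbb{R}^d \}.$$ Let $$F = (d+1)\left( a^4 + \sum_{j=1}^{d+1} T_j^4 \right) - \left( a^2 + \sum_{j=1}^{d+1} T_j^2 \right)^2 .$$ Then $I$ is the principal ideal of $R$ generated by $F$.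
   Context: A regular $d$-simplex $[\mathbf{v}_1,\ldots,\mathbf{v}_{d+1}]$ of edge length $a>0$ in $\mathbb{R}^d$ is the convex hull of $d+1$ points with $\|\mathbf{v}_i-\mathbf{v}_j\| = a$ for all $i \ne j$; the points $\mathbf{v}_j$ are its vertices. Here $\|\cdot\|$ is the Euclidean norm. *)

theory Defs
  imports "HOL-Analysis.Analysis" "HOL-Library.Poly_Mapping"
begin

text \<open>
  The ring of polynomials over \<open>'a\<close> in finitely many indeterminates indexed by the type \<open>'k\<close>:
  a polynomial is the finitely supported map from monomials (exponent vectors) to coefficients,
  and its ring structure is the convolution product of \<^theory>\<open>HOL-Library.Poly_Mapping\<close>.
\<close>

type_synonym ('k, 'a) mpoly = "('k \<Rightarrow>\<^sub>0 nat) \<Rightarrow>\<^sub>0 'a"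

definition mpoly_const :: "'a \<Rightarrow> ('k, 'a::comm_ring_1) mpoly"
  where "mpoly_const c = Poly_Mapping.single 0 c"

definition mpoly_var :: "'k \<Rightarrow> ('k, 'a::comm_ring_1) mpoly"
  where "mpoly_var j = Poly_Mapping.single (Poly_Mapping.single j 1) 1"

definition mpoly_eval :: "('k::finite \<Rightarrow> 'a) \<Rightarrow> ('k, 'a::comm_ring_1) mpoly \<Rightarrow> 'a"
  where "mpoly_eval x p =
    (\<Sum>m\<in>Poly_Mapping.keys p. Poly_Mapping.lookup p m * (\<Prod>j\<in>UNIV. x j ^ Poly_Mapping.lookup m j))"

definition principal_ideal :: "'r::comm_ring_1 \<Rightarrow> 'r set"
  where "principal_ideal p = {q * p | q. True}"

text \<open>
  The vertices are a family \<open>v\<close> indexed by \<open>'k\<close>, so \<open>S\<close> is a regular \<open>d\<close>-simplex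
  for \<open>d = CARD('k) - 1\<close>.
\<close>

definition regular_simplex :: "real \<Rightarrow> ('k::finite \<Rightarrow> 'a::euclidean_space) \<Rightarrow> 'a set \<Rightarrow> bool"
  where "regular_simplex a v S \<longleftrightarrow>
    0 < a \<and> (\<forall>i j. i \<noteq> j \<longrightarrow> norm (v i - v j) = a) \<and> S = convex hull (range v)"

end

theory Submission
  imports Defs "HOL-Complex_Analysis.Complex_Analysis"
begin

text \<open>
  Let \<open>w j\<close> be the vertices relative to the centroid. Since \<open>y \<mapsto> 2/a\<^sup>2 \<Sum>\<^sub>j (y \<bullet> w j) w j\<close> is the identity,
  a nonnegative vector \<open>x\<close> is the vector of distances from some point to the vertices iff \<open>F(x) = 0\<close>.
  Fix an indeterminate \<open>T k\<close>. As a polynomial in \<open>T k\<close>, \<open>F\<close> has degree 4 and leading coefficient \<open>d\<close>,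
  so each \<open>f \<in> I\<close> is congruent modulo \<open>F\<close> to some \<open>r \<in> I\<close> of degree at most 3 in \<open>T k\<close>.
  Along a line through \<open>v k\<close> that misses the other vertices, all distances are analytic in the line
  parameter \<open>s\<close> except the one to \<open>v k\<close>, which is \<open>\<bar>s\<bar>\<close> up to scaling; continuing analytically
  through \<open>s = 0\<close> shows that \<open>r\<close> also vanishes after the sign of the distance to \<open>v k\<close> is flipped
  (lines missing the other vertices are generic because \<open>d \<ge> 2\<close>). If the other distances lie just
  above \<open>2a\<close>, then \<open>F\<close> has two distinct positive roots in \<open>T k\<close>, so \<open>r\<close> has four roots in \<open>T k\<close>;
  hence \<open>r\<close> vanishes on a box and \<open>r = 0\<close>.
\<close>

section \<open>Evaluation of polynomials\<close>

lemma poly_mapping_expansion: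
  "p = (\<Sum>m\<in>Poly_Mapping.keys p. Poly_Mapping.single m (Poly_Mapping.lookup p m))"
  by (rule poly_mapping_eqI)
    (auto simp: lookup_sum lookup_single when_def not_in_keys_iff_lookup_eq_zero sum.delta)

lemma mpoly_eval_zero [simp]: "mpoly_eval x 0 = 0"
  by (simp add: mpoly_eval_def)

lemma mpoly_eval_single [simp]:
  "mpoly_eval x (Poly_Mapping.single m c) = c * (\<Prod>j\<in>UNIV. x j ^ Poly_Mapping.lookup m j)"
  by (simp add: mpoly_eval_def)

lemma mpoly_eval_add [simp]: "mpoly_eval x (p + q) = mpoly_eval x p + mpoly_eval x q"
  unfolding mpoly_eval_def by (rule setsum_keys_plus_distrib) (auto simp: distrib_right)

lemma mpoly_eval_sum [simp]: "mpoly_eval x (\<Sum>i\<in>A. f i) = (\<Sum>i\<in>A. mpoly_eval x (f i))"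
  by (induction A rule: infinite_finite_induct) auto

lemma mpoly_eval_uminus [simp]: "mpoly_eval x (- p) = - mpoly_eval x p"
  by (simp add: mpoly_eval_def sum_negf)

lemma mpoly_eval_diff [simp]: "mpoly_eval x (p - q) = mpoly_eval x p - mpoly_eval x q"
  using mpoly_eval_add[of x p "- q"] by simp

lemma mpoly_eval_mult [simp]: "mpoly_eval x (p * q) = mpoly_eval x p * mpoly_eval x q"
proof -
  have "p * q = (\<Sum>m\<in>Poly_Mapping.keys p. \<Sum>n\<in>Poly_Mapping.keys q.
      Poly_Mapping.single (m + n) (Poly_Mapping.lookup p m * Poly_Mapping.lookup q n))"
    by (subst poly_mapping_expansion[of p], subst poly_mapping_expansion[of q])
      (simp add: sum_product mult_single)
  then have "mpoly_eval x (p * q) = (\<Sum>m\<in>Poly_Mapping.keys p. \<Sum>n\<in>Poly_Mapping.keys q.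
      mpoly_eval x (Poly_Mapping.single (m + n) (Poly_Mapping.lookup p m * Poly_Mapping.lookup q n)))"
    by (simp only: mpoly_eval_sum)
  also have "\<dots> = mpoly_eval x p * mpoly_eval x q"
    unfolding mpoly_eval_single unfolding mpoly_eval_def sum_product
    by (simp add: lookup_add power_add prod.distrib mult_ac)
  finally show ?thesis .
qed

lemma mpoly_eval_const [simp]: "mpoly_eval x (mpoly_const c) = c"
  by (simp add: mpoly_const_def)

lemma mpoly_eval_var [simp]: "mpoly_eval x (mpoly_var j) = x j"
proof -
  have "(\<Prod>i\<in>UNIV. x i ^ Poly_Mapping.lookup (Poly_Mapping.single j (1::nat)) i) =
    (\<Prod>i\<in>UNIV. if i = j then x i else 1)"
    by (intro prod.cong) (auto simp: lookup_single when_def)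
  then show ?thesis by (simp add: mpoly_var_def)
qed

lemma mpoly_eval_one [simp]: "mpoly_eval x 1 = 1"
  using mpoly_eval_const[of x 1] by (simp add: mpoly_const_def)

lemma mpoly_eval_power [simp]: "mpoly_eval x (p ^ n) = mpoly_eval x p ^ n"
  by (induction n) auto

lemma mpoly_eval_of_nat [simp]: "mpoly_eval x (of_nat n) = of_nat n"
  by (induction n) auto

lemma mpoly_const_of_nat: "mpoly_const (of_nat n) = of_nat n"
  by (simp add: mpoly_const_def)

section \<open>Polynomials vanishing on a box\<close>

lemma sum_by_exponent:
  fixes t :: "'a::comm_semiring_1"
  assumes "finite M" "\<And>m. m \<in> M \<Longrightarrow> f m \<le> n"
  shows "(\<Sum>m\<in>M. t ^ f m * g m) = (\<Sum>i\<le>n. (\<Sum>m\<in>{m\<in>M. f m = i}. g m) * t ^ i)"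
proof -
  have "(\<Sum>m\<in>M. t ^ f m * g m) = (\<Sum>i\<le>n. \<Sum>m\<in>{m\<in>M. f m = i}. t ^ f m * g m)"
    using assms by (intro sum.group[symmetric]) auto
  also have "\<dots> = (\<Sum>i\<le>n. (\<Sum>m\<in>{m\<in>M. f m = i}. g m) * t ^ i)"
    by (intro sum.cong refl) (auto simp: sum_distrib_left mult.commute)
  finally show ?thesis .
qed

text \<open>A nonzero polynomial of degree at most \<open>n\<close> has at most \<open>n\<close>
  roots. Infinite \<open>A\<close> is a separate case because \<open>card\<close> of an infinite set
  is 0.\<close>

lemma coeff_zero_of_many_roots:
  fixes c :: "nat \<Rightarrow> 'a::idom"
  assumes "\<And>t. t \<in> A \<Longrightarrow> (\<Sum>i\<le>n. c i * t ^ i) = 0" "infinite A \<or> n < card A" "i \<le> n"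
  shows "c i = 0"
proof (rule ccontr)
  define p where "p = (\<Sum>i\<le>n. monom (c i) i)"
  assume "c i \<noteq> 0"
  moreover have "coeff p i = c i"
    using \<open>i \<le> n\<close> by (simp add: p_def coeff_sum)
  ultimately have "p \<noteq> 0" by auto
  moreover have "degree p \<le> n"
    unfolding p_def by (intro degree_sum_le) (auto intro: order_trans[OF degree_monom_le])
  moreover have sub: "A \<subseteq> {t. poly p t = 0}"
    using assms(1) by (auto simp: p_def poly_sum poly_monom)
  ultimately show False
    using assms(2) poly_roots_finite[of p] card_poly_roots_bound[of p]
      card_mono[OF _ sub] finite_subset[OF sub] by fastforce
qed

lemma monomials_independent_on_box:
  fixes A :: "'k \<Rightarrow> 'a::idom set" and e :: "'m \<Rightarrow> 'k \<Rightarrow> nat"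
  assumes "finite J" "finite M" "\<And>j. j \<in> J \<Longrightarrow> infinite (A j)"
    and "\<And>m n. \<lbrakk>m \<in> M; n \<in> M; \<And>j. j \<in> J \<Longrightarrow> e m j = e n j\<rbrakk> \<Longrightarrow> m = n"
    and "\<And>x. (\<And>j. j \<in> J \<Longrightarrow> x j \<in> A j) \<Longrightarrow> (\<Sum>m\<in>M. c m * (\<Prod>j\<in>J. x j ^ e m j)) = 0"
    and "m \<in> M"
  shows "c m = 0"
  using assms
proof (induction J arbitrary: M m rule: finite_induct)
  case empty
  then have "M = {m}" by auto
  with empty.prems(4)[of "\<lambda>_. undefined"] show ?case by simp
next
  case (insert k J)
  define n where "n = (MAX m\<in>M. e m k)"
  have n: "e m k \<le> n" if "m \<in> M" for m
    unfolding n_def using that insert.prems(1) by simp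
  show ?case
  proof (rule insert.IH[of "{l\<in>M. e l k = e m k}"])
    fix x assume x: "\<And>j. j \<in> J \<Longrightarrow> x j \<in> A j"
    show "(\<Sum>l\<in>{l\<in>M. e l k = e m k}. c l * (\<Prod>j\<in>J. x j ^ e l j)) = 0"
    proof (rule coeff_zero_of_many_roots[where A = "A k" and n = n and i = "e m k" and
          c = "\<lambda>i. \<Sum>l\<in>{l\<in>M. e l k = i}. c l * (\<Prod>j\<in>J. x j ^ e l j)"])
      fix t assume t: "t \<in> A k"
      have "0 = (\<Sum>l\<in>M. c l * (\<Prod>j\<in>insert k J. (x(k := t)) j ^ e l j))"
        using x t by (intro insert.prems(4)[symmetric]) auto
      also have "\<dots> = (\<Sum>l\<in>M. t ^ e l k * (c l * (\<Prod>j\<in>J. x j ^ e l j)))"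
      proof (intro sum.cong refl)
        fix l
        have "(\<Prod>j\<in>J. (x(k := t)) j ^ e l j) = (\<Prod>j\<in>J. x j ^ e l j)"
          using insert.hyps by (intro prod.cong) auto
        with insert.hyps show "c l * (\<Prod>j\<in>insert k J. (x(k := t)) j ^ e l j) =
          t ^ e l k * (c l * (\<Prod>j\<in>J. x j ^ e l j))" by (simp add: mult_ac)
      qed
      finally show "(\<Sum>i\<le>n. (\<Sum>l\<in>{l\<in>M. e l k = i}. c l * (\<Prod>j\<in>J. x j ^ e l j)) * t ^ i) = 0"
        using sum_by_exponent[of M "\<lambda>m. e m k" n t] n insert.prems(1) by simp
    qed (use insert.prems n in auto)
  next
    fix l l' assume "l \<in> {l\<in>M. e l k = e m k}" "l' \<in> {l\<in>M. e l k = e m k}"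
      "\<And>j. j \<in> J \<Longrightarrow> e l j = e l' j"
    then show "l = l'" by (intro insert.prems(3)) auto
  qed (use insert.prems in auto)
qed

lemma mpoly_zero_on_box:
  fixes p :: "('k::finite, 'a::idom) mpoly"
  assumes "\<And>j. infinite (A j)" and "\<And>x. (\<And>j. x j \<in> A j) \<Longrightarrow> mpoly_eval x p = 0"
  shows "p = 0"
proof (rule poly_mapping_eqI)
  fix m
  have "Poly_Mapping.lookup p m = 0" if "m \<in> Poly_Mapping.keys p"
    by (rule monomials_independent_on_box[where J = UNIV and M = "Poly_Mapping.keys p"
          and e = Poly_Mapping.lookup and A = A and c = "Poly_Mapping.lookup p"])
      (use that assms in \<open>auto simp: mpoly_eval_def intro: poly_mapping_eqI\<close>)
  then show "Poly_Mapping.lookup p m = Poly_Mapping.lookup 0 m"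
    by (auto simp: in_keys_iff)
qed

section \<open>Division with remainder in one variable\<close>

text \<open>A bound in place of a degree, so that the zero polynomial needs no convention.\<close>

definition degree_in_le :: "'k \<Rightarrow> nat \<Rightarrow> ('k, 'a::comm_ring_1) mpoly \<Rightarrow> bool"
  where "degree_in_le k n p \<longleftrightarrow> (\<forall>m\<in>Poly_Mapping.keys p. Poly_Mapping.lookup m k \<le> n)"

lemma degree_in_le_mono: "degree_in_le k n p \<Longrightarrow> n \<le> n' \<Longrightarrow> degree_in_le k n' p"
  unfolding degree_in_le_def by fastforce

lemma degree_in_le_add: "degree_in_le k n p \<Longrightarrow> degree_in_le k n q \<Longrightarrow> degree_in_le k n (p + q)"
  unfolding degree_in_le_def using keys_add[of p q] by blast

lemma degree_in_le_diff: "degree_in_le k n p \<Longrightarrow> degree_in_le k n q \<Longrightarrow> degree_in_le k n (p - q)"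
  unfolding degree_in_le_def using keys_diff[of p q] by blast

lemma degree_in_le_sum:
  "(\<And>i. i \<in> A \<Longrightarrow> degree_in_le k n (f i)) \<Longrightarrow> degree_in_le k n (\<Sum>i\<in>A. f i)"
  unfolding degree_in_le_def using keys_sum[of f A] by blast

lemma degree_in_le_mult:
  assumes "degree_in_le k n p" "degree_in_le k n' q"
  shows "degree_in_le k (n + n') (p * q)"
  unfolding degree_in_le_def
proof
  fix m assume "m \<in> Poly_Mapping.keys (p * q)"
  then obtain a b where "m = a + b" "a \<in> Poly_Mapping.keys p" "b \<in> Poly_Mapping.keys q"
    using keys_mult[of p q] by blast
  with assms show "Poly_Mapping.lookup m k \<le> n + n'"
    by (auto simp: degree_in_le_def lookup_add intro: add_mono)
qed

lemma degree_in_le_single: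
  "Poly_Mapping.lookup m k \<le> n \<Longrightarrow> degree_in_le k n (Poly_Mapping.single m c)"
  by (simp add: degree_in_le_def)

lemma degree_in_le_const: "degree_in_le k n (mpoly_const c)"
  by (simp add: mpoly_const_def degree_in_le_single)

lemma degree_in_le_power: "degree_in_le k n p \<Longrightarrow> degree_in_le k (i * n) (p ^ i)"
proof (induction i)
  case 0
  then show ?case by (simp add: degree_in_le_def)
next
  case (Suc i)
  then show ?case using degree_in_le_mult[of k n p "i * n" "p ^ i"] by simp
qed

lemma degree_in_le_var: "degree_in_le k 1 (mpoly_var j)"
  by (auto simp: mpoly_var_def degree_in_le_single lookup_single when_def)

lemma degree_in_le_other_var: "j \<noteq> k \<Longrightarrow> degree_in_le k 0 (mpoly_var j)"
  by (auto simp: mpoly_var_def degree_in_le_single lookup_single when_def)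

lemma mpoly_var_power: "mpoly_var k ^ n = Poly_Mapping.single (Poly_Mapping.single k n) 1"
proof (induction n)
  case (Suc n)
  then show ?case
    by (simp add: mpoly_var_def mult_single single_add[symmetric])
qed simp

text \<open>The leading coefficient of \<open>F\<close> in the variable \<open>k\<close> is a
  nonzero constant, so a monomial of degree above \<open>s\<close> can be divided by the leading
  term. Modulo \<open>F\<close> the monomial becomes \<open>- q * G\<close>, whose degree in
  \<open>k\<close> is smaller by at least one; strong induction on the degree bound
  finishes.\<close>

lemma mpoly_division_in_variable:
  fixes G p :: "('k, 'a::field) mpoly"
  assumes G: "degree_in_le k s G" and "c \<noteq> 0"
  defines "F \<equiv> mpoly_const c * mpoly_var k ^ Suc s + G"
  shows "\<exists>q r. p = q * F + r \<and> degree_in_le k s r"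
proof -
  have "\<exists>q r. p = q * F + r \<and> degree_in_le k s r" if "degree_in_le k n p" for n p
    using that
  proof (induction n arbitrary: p rule: less_induct)
    case (less n)
    let ?term = "\<lambda>m. Poly_Mapping.single m (Poly_Mapping.lookup p m)"
    have "\<exists>q r. ?term m = q * F + r \<and> degree_in_le k s r" if "m \<in> Poly_Mapping.keys p" for m
    proof (cases "Poly_Mapping.lookup m k \<le> s")
      case True
      then show ?thesis
        by (intro exI[of _ 0] exI[of _ "?term m"]) (simp add: degree_in_le_single)
    next
      case False
      define l where "l = m - Poly_Mapping.single k (Suc s)"
      define q where "q = Poly_Mapping.single l (Poly_Mapping.lookup p m / c)"
      have m: "m = l + Poly_Mapping.single k (Suc s)"
        using False by (intro poly_mapping_eqI)
          (auto simp: l_def lookup_add lookup_minus lookup_single when_def)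
      have n: "Poly_Mapping.lookup m k \<le> n"
        using less.prems that by (simp add: degree_in_le_def)
      have l: "Poly_Mapping.lookup l k = Poly_Mapping.lookup m k - Suc s"
        by (simp add: m lookup_add)
      have single_eq: "?term m = q * F - q * G"
        unfolding F_def mpoly_var_power mpoly_const_def q_def
        by (simp add: algebra_simps mult_single m[symmetric] \<open>c \<noteq> 0\<close>)
      have "degree_in_le k (Poly_Mapping.lookup l k + s) (q * G)"
        unfolding q_def by (intro degree_in_le_mult G degree_in_le_single order_refl)
      moreover have "Poly_Mapping.lookup l k + s < n"
        using False n l by simp
      ultimately obtain q' r where "q * G = q' * F + r" "degree_in_le k s r"
        using less.IH by blast
      then show ?thesis
        using single_eq degree_in_le_diff[of k s 0 r]
        by (intro exI[of _ "q - q'"] exI[of _ "- r"]) (auto simp: algebra_simps degree_in_le_def)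
    qed
    then obtain q r where qr: "\<And>m. m \<in> Poly_Mapping.keys p \<Longrightarrow>
        ?term m = q m * F + r m \<and> degree_in_le k s (r m)"
      by metis
    have "p = (\<Sum>m\<in>Poly_Mapping.keys p. q m * F + r m)"
      using qr by (subst poly_mapping_expansion[of p]) (auto intro: sum.cong)
    then show ?case
      using qr by (intro exI[of _ "\<Sum>m\<in>Poly_Mapping.keys p. q m"]
          exI[of _ "\<Sum>m\<in>Poly_Mapping.keys p. r m"])
        (auto simp: sum.distrib sum_distrib_right intro: degree_in_le_sum)
  qed
  moreover have "degree_in_le k (MAX m\<in>Poly_Mapping.keys p. Poly_Mapping.lookup m k) p"
    by (simp add: degree_in_le_def)
  ultimately show ?thesis by blast
qed

text \<open>Freeze all variables but \<open>k\<close>. The many roots in \<open>B\<close>, which may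
  depend on \<open>x\<close>, kill every coefficient of the resulting polynomial in one variable, so
  \<open>r\<close> vanishes at \<open>x\<close> itself even if \<open>x k\<close> is not in
  \<open>B\<close>. Hence \<open>r\<close> vanishes on the whole box.\<close>

lemma mpoly_zero_of_many_roots:
  fixes r :: "('k::finite, 'a::idom) mpoly"
  assumes deg: "degree_in_le k n r" and "\<And>j. infinite (A j)"
    and roots: "\<And>x. (\<And>j. x j \<in> A j) \<Longrightarrow>
      \<exists>B. (infinite B \<or> n < card B) \<and> (\<forall>t\<in>B. mpoly_eval (x(k := t)) r = 0)"
  shows "r = 0"
proof (rule mpoly_zero_on_box[of A])
  fix x :: "'k \<Rightarrow> 'a" assume x: "\<And>j. x j \<in> A j"
  define c where "c i = (\<Sum>m\<in>{m\<in>Poly_Mapping.keys r. Poly_Mapping.lookup m k = i}.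
      Poly_Mapping.lookup r m * (\<Prod>j\<in>UNIV - {k}. x j ^ Poly_Mapping.lookup m j))" for i
  have eval: "mpoly_eval (x(k := t)) r = (\<Sum>i\<le>n. c i * t ^ i)" for t
  proof -
    have "mpoly_eval (x(k := t)) r = (\<Sum>m\<in>Poly_Mapping.keys r. t ^ Poly_Mapping.lookup m k *
        (Poly_Mapping.lookup r m * (\<Prod>j\<in>UNIV - {k}. x j ^ Poly_Mapping.lookup m j)))"
      unfolding mpoly_eval_def
    proof (intro sum.cong refl)
      fix m
      have "(\<Prod>j\<in>UNIV - {k}. (x(k := t)) j ^ Poly_Mapping.lookup m j) =
        (\<Prod>j\<in>UNIV - {k}. x j ^ Poly_Mapping.lookup m j)"
        by (intro prod.cong) auto
      then show "Poly_Mapping.lookup r m * (\<Prod>j\<in>UNIV. (x(k := t)) j ^ Poly_Mapping.lookup m j) =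
        t ^ Poly_Mapping.lookup m k *
        (Poly_Mapping.lookup r m * (\<Prod>j\<in>UNIV - {k}. x j ^ Poly_Mapping.lookup m j))"
        by (simp add: prod.remove[of UNIV k] mult_ac)
    qed
    also have "\<dots> = (\<Sum>i\<le>n. c i * t ^ i)"
      unfolding c_def using deg by (intro sum_by_exponent) (auto simp: degree_in_le_def)
    finally show ?thesis .
  qed
  obtain B where B: "infinite B \<or> n < card B" "\<forall>t\<in>B. mpoly_eval (x(k := t)) r = 0"
    using roots[OF x] by blast
  have "c i = 0" if "i \<le> n" for i
    using B that by (intro coeff_zero_of_many_roots[where A = B and n = n and c = c]) (auto simp: eval)
  then show "mpoly_eval x r = 0"
    using eval[of "x k"] by simp
qed (use assms in auto)

section \<open>Distances to the vertices of a regular simplex\<close>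

lemma norm_scaleR_diff_sq:
  fixes x y :: "'a::real_inner"
  shows "(norm (r *\<^sub>R x - y))\<^sup>2 = r\<^sup>2 * (x \<bullet> x) - 2 * r * (x \<bullet> y) + y \<bullet> y"
  unfolding power2_norm_eq_inner
  by (simp add: inner_diff_left inner_diff_right inner_commute[of y x] power2_eq_square algebra_simps)

locale equidistant_points =
  fixes v :: "'k::finite \<Rightarrow> 'a::euclidean_space" and a N :: real
  assumes card_vertices: "real CARD('k) = N"
    and edge_pos: "0 < a" and edge: "i \<noteq> j \<Longrightarrow> norm (v i - v j) = a"
begin

section \<open>Vertices relative to the centroid and their Gram matrix\<close>

definition w :: "'k \<Rightarrow> 'a" where "w j = v j - (1 / N) *\<^sub>R (\<Sum>i\<in>UNIV. v i)"

text \<open>The polynomial \<open>F\<close> as a function of real arguments, with \<open>N\<close>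
  in the role of \<open>d + 1\<close>.\<close>

definition distance_form :: "('k \<Rightarrow> real) \<Rightarrow> real"
  where "distance_form x = N * (a ^ 4 + (\<Sum>j\<in>UNIV. x j ^ 4)) - (a\<^sup>2 + (\<Sum>j\<in>UNIV. (x j)\<^sup>2))\<^sup>2"

lemma N_pos: "N > 0"
  by (simp flip: card_vertices)

declare card_vertices [simp]

text \<open>Polarization: the inner product of two differences of points is a combination of four
  squared distances, each of which is 0 or \<open>a^2\<close>.\<close>

lemma edge_inner:
  "(v i - v l) \<bullet> (v j - v m) =
    a\<^sup>2 / 2 * (of_bool (i = j) + of_bool (l = m) - of_bool (i = m) - of_bool (j = l))"
proof -
  have sq: "(v p - v q) \<bullet> (v p - v q) = a\<^sup>2 * (1 - of_bool (p = q))" for p q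
    using edge[of p q] by (auto simp: power2_norm_eq_inner[symmetric])
  have "2 * ((v i - v l) \<bullet> (v j - v m)) = (v i - v m) \<bullet> (v i - v m) + (v j - v l) \<bullet> (v j - v l)
      - (v i - v j) \<bullet> (v i - v j) - (v l - v m) \<bullet> (v l - v m)"
    by (simp add: inner_diff_left inner_diff_right inner_commute)
  then have "2 * ((v i - v l) \<bullet> (v j - v m)) =
      a\<^sup>2 * (of_bool (i = j) + of_bool (l = m) - of_bool (i = m) - of_bool (j = l))"
    unfolding sq by (simp only: algebra_simps)
  then show ?thesis by simp
qed

lemma w_conv_sum: "w i = (1 / N) *\<^sub>R (\<Sum>l\<in>UNIV. v i - v l)"
  using N_pos by (simp add: w_def sum_subtractf scaleR_diff_right sum_constant_scaleR)

lemma sum_w: "(\<Sum>j\<in>UNIV. w j) = 0"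
  using N_pos by (simp add: w_def sum_subtractf sum_constant_scaleR)

text \<open>Each \<open>w i\<close> is the average of the differences \<open>v i - v l\<close>, so
  this is \<open>edge_inner\<close> averaged over \<open>l\<close> and \<open>m\<close>.\<close>

lemma gram: "w i \<bullet> w j = a\<^sup>2 / 2 * (of_bool (i = j) - 1 / N)"
proof -
  have "w i \<bullet> w j = (\<Sum>l\<in>UNIV. \<Sum>m\<in>UNIV. (v i - v l) \<bullet> (v j - v m)) / N\<^sup>2"
    unfolding w_conv_sum[of i] w_conv_sum[of j] inner_scaleR_left inner_scaleR_right
      inner_sum_left inner_sum_right
    by (subst sum.swap) (simp add: power2_eq_square sum_divide_distrib)
  also have "\<dots> = (a\<^sup>2 / 2 * (N * N * of_bool (i = j) - N)) / N\<^sup>2"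
    unfolding edge_inner sum_distrib_left[symmetric]
    by (simp add: sum.distrib sum_subtractf sum_distrib_left[symmetric] of_bool_def)
  also have "\<dots> = a\<^sup>2 / 2 * (of_bool (i = j) - 1 / N)"
    using N_pos by (simp add: field_simps power2_eq_square)
  finally show ?thesis .
qed

lemma norm_w: "(norm (w i))\<^sup>2 = a\<^sup>2 / 2 * (1 - 1 / N)"
  using gram[of i i] by (simp add: power2_norm_eq_inner)

text \<open>
  The map \<open>y \<mapsto> 2/a\<^sup>2 \<Sum>\<^sub>j (y \<bullet> w j) w j\<close> is the orthogonal projection onto the span of the \<open>w j\<close>;
  its trace is \<open>CARD('k) - 1\<close>, so it is the identity.
\<close>
lemma parseval:
  assumes dim: "CARD('k) = DIM('a) + 1"
  shows "(norm y)\<^sup>2 = 2 / a\<^sup>2 * (\<Sum>j\<in>UNIV. (y \<bullet> w j)\<^sup>2)"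
proof -
  define P where "P y = (2 / a\<^sup>2) *\<^sub>R (\<Sum>j\<in>UNIV. (y \<bullet> w j) *\<^sub>R w j)" for y
  have P_inner: "P y \<bullet> z = 2 / a\<^sup>2 * (\<Sum>j\<in>UNIV. (y \<bullet> w j) * (z \<bullet> w j))" for y z
    by (simp add: P_def inner_sum_left inner_commute[of z])
  have P_w: "P y \<bullet> w i = y \<bullet> w i" for y i
  proof -
    have "P y \<bullet> w i = 2 / a\<^sup>2 * (\<Sum>j\<in>UNIV. (y \<bullet> w j) * (a\<^sup>2 / 2 * (of_bool (i = j) - 1 / N)))"
      unfolding P_inner gram ..
    also have "\<dots> = (\<Sum>j\<in>UNIV. (y \<bullet> w j) * of_bool (i = j) - (y \<bullet> w j) / N)"
      using edge_pos unfolding sum_distrib_left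
      by (intro sum.cong refl) (simp add: right_diff_distrib)
    also have "\<dots> = (\<Sum>j\<in>UNIV. (y \<bullet> w j) * of_bool (i = j)) - (\<Sum>j\<in>UNIV. y \<bullet> w j) / N"
      by (simp only: sum_subtractf sum_divide_distrib)
    also have "(\<Sum>j\<in>UNIV. y \<bullet> w j) = 0"
      by (simp add: inner_sum_right[symmetric] sum_w)
    finally show ?thesis
      by (simp add: of_bool_def if_distrib sum.delta cong: if_cong)
  qed
  have P_sq: "P y \<bullet> P y = P y \<bullet> y" for y
    by (subst (1 2) P_inner) (simp add: P_w)
  \<comment> \<open>The right side is the dimension minus the trace of \<open>P\<close>. Once it is
    known to be 0, every square on the left is 0.\<close>
  have "(\<Sum>b\<in>Basis. (norm (b - P b))\<^sup>2) = (\<Sum>b\<in>Basis. 1 - P b \<bullet> b)"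
  proof (intro sum.cong refl)
    fix b :: 'a assume "b \<in> Basis"
    then show "(norm (b - P b))\<^sup>2 = 1 - P b \<bullet> b"
      by (simp add: power2_norm_eq_inner inner_diff_left inner_diff_right P_sq inner_commute)
  qed
  also have "\<dots> = real DIM('a) - 2 / a\<^sup>2 * (\<Sum>b\<in>Basis. \<Sum>j\<in>UNIV. (w j \<bullet> b)\<^sup>2)"
    unfolding P_inner sum_subtractf sum_distrib_left[symmetric]
    by (simp add: power2_eq_square inner_commute)
  also have "(\<Sum>b\<in>Basis. \<Sum>j\<in>UNIV. (w j \<bullet> b)\<^sup>2) = (\<Sum>j\<in>UNIV. (norm (w j))\<^sup>2)"
    unfolding power2_norm_eq_inner unfolding power2_eq_square
    by (subst sum.swap) (simp add: euclidean_inner[symmetric])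
  also have "\<dots> = a\<^sup>2 / 2 * (N - 1)"
    using N_pos by (simp add: norm_w field_simps)
  also have "real DIM('a) - 2 / a\<^sup>2 * (a\<^sup>2 / 2 * (N - 1)) = 0"
    using edge_pos card_vertices[unfolded dim] by (simp add: algebra_simps)
  finally have "P b = b" if "b \<in> Basis" for b
    using that by (simp add: sum_nonneg_eq_0_iff)
  \<comment> \<open>Symmetry of \<open>P\<close> carries the identity from basis vectors to every
    \<open>y\<close>.\<close>
  then have "P y \<bullet> b = y \<bullet> b" if "b \<in> Basis" for b
    using that P_inner[of y b] P_inner[of b y] by (simp add: inner_commute mult.commute)
  then have "P y = y"
    by (rule euclidean_eqI)
  then show ?thesis
    using P_inner[of y y] unfolding power2_norm_eq_inner by (simp add: power2_eq_square)
qed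

section \<open>Distance vectors as the nonnegative zeros of the form\<close>

text \<open>With the origin moved to the centroid, the squared distances differ from one another
  only in a term linear in \<open>y\<close>.\<close>

lemma norm_diff_vertex:
  defines "c \<equiv> (1 / N) *\<^sub>R (\<Sum>i\<in>UNIV. v i)"
  shows "(norm (c + y - v j))\<^sup>2 = (norm y)\<^sup>2 - 2 * (y \<bullet> w j) + a\<^sup>2 / 2 * (1 - 1 / N)"
proof -
  have "c + y - v j = y - w j" by (simp add: w_def c_def)
  then show ?thesis
    unfolding norm_w[of j, symmetric] power2_norm_eq_inner
    by (simp only: inner_diff_left inner_diff_right inner_commute[of "w j" y])
qed

text \<open>Summing the squared distances removes the linear terms, since the \<open>w j\<close> add
  up to 0; summing their squares leaves \<open>(norm y)^2\<close> by \<open>parseval\<close>. Both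
  sums are thus functions of \<open>(norm y)^2\<close> alone, and eliminating it gives the
  relation.\<close>

lemma distance_form_vanishes:
  assumes dim: "CARD('k) = DIM('a) + 1"
  shows "distance_form (\<lambda>j. norm (t - v j)) = 0"
proof -
  define y where "y = t - (1 / N) *\<^sub>R (\<Sum>i\<in>UNIV. v i)"
  define q where "q = (norm y)\<^sup>2 + a\<^sup>2 / 2 * (1 - 1 / N)"
  have sq: "(norm (t - v j))\<^sup>2 = q - 2 * (y \<bullet> w j)" for j
    using norm_diff_vertex[of y j] by (simp add: y_def q_def)
  have lin: "(\<Sum>j\<in>UNIV. y \<bullet> w j) = 0"
    by (simp add: inner_sum_right[symmetric] sum_w)
  have s2: "(\<Sum>j\<in>UNIV. (norm (t - v j))\<^sup>2) = N * q"
    by (simp add: sq sum_subtractf sum_distrib_left[symmetric] lin)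
  have "(\<Sum>j\<in>UNIV. norm (t - v j) ^ 4) = (\<Sum>j\<in>UNIV. (q - 2 * (y \<bullet> w j))\<^sup>2)"
    unfolding sq[symmetric] by simp
  also have "\<dots> = (\<Sum>j\<in>UNIV. q\<^sup>2 - 4 * q * (y \<bullet> w j) + 4 * (y \<bullet> w j)\<^sup>2)"
    by (intro sum.cong refl) (simp add: power2_eq_square algebra_simps)
  also have "\<dots> = N * q\<^sup>2 + 4 * (\<Sum>j\<in>UNIV. (y \<bullet> w j)\<^sup>2)"
    by (simp add: sum.distrib sum_subtractf sum_distrib_left[symmetric] lin)
  also have "(\<Sum>j\<in>UNIV. (y \<bullet> w j)\<^sup>2) = a\<^sup>2 / 2 * (norm y)\<^sup>2"
    using parseval[OF dim, of y] edge_pos by (simp add: field_simps)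
  finally have s4: "(\<Sum>j\<in>UNIV. norm (t - v j) ^ 4) = N * q\<^sup>2 + 2 * a\<^sup>2 * (norm y)\<^sup>2"
    by simp
  have Nq: "2 * N * q = 2 * N * (norm y)\<^sup>2 + a\<^sup>2 * (N - 1)"
    using N_pos by (simp add: q_def field_simps)
  have "distance_form (\<lambda>j. norm (t - v j)) =
      (N - 1) * a ^ 4 + a\<^sup>2 * (2 * N * (norm y)\<^sup>2) - a\<^sup>2 * (2 * N * q)"
    unfolding distance_form_def s2 s4
    by (simp add: power2_eq_square algebra_simps power4_eq_xxxx)
  also have "\<dots> = 0"
    unfolding Nq by (simp add: power2_eq_square algebra_simps power4_eq_xxxx)
  finally show ?thesis .
qed

text \<open>Differences of squared distances prescribe the products \<open>y \<bullet> w j\<close>,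
  and a suitable \<open>y\<close> always exists. What remains is that \<open>norm y\<close> has the
  right value, and this is what the vanishing of the form provides.\<close>

lemma exists_point_with_distances:
  assumes nonneg: "\<And>j. 0 \<le> x j" and form: "distance_form x = 0"
  shows "\<exists>t. \<forall>j. norm (t - v j) = x j"
proof -
  define s where "s = (\<Sum>j\<in>UNIV. (x j)\<^sup>2)"
  \<comment> \<open>This is \<open>2 / a^2\<close> times the sum of
    \<open>(y \<bullet> w j) *\<^sub>R w j\<close> with the prescribed products inserted; the mean
    of the squares drops out because the \<open>w j\<close> sum to 0.\<close>
  define y where "y = - (1 / a\<^sup>2) *\<^sub>R (\<Sum>j\<in>UNIV. (x j)\<^sup>2 *\<^sub>R w j)"
  have y_inner: "y \<bullet> z = - (1 / a\<^sup>2) * (\<Sum>j\<in>UNIV. (x j)\<^sup>2 * (w j \<bullet> z))" for z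
    by (simp add: y_def inner_sum_left)
  have y_w: "y \<bullet> w i = (s / N - (x i)\<^sup>2) / 2" for i
  proof -
    have "y \<bullet> w i = - (1 / a\<^sup>2) * (\<Sum>j\<in>UNIV. (x j)\<^sup>2 * (a\<^sup>2 / 2 * (of_bool (j = i) - 1 / N)))"
      by (simp only: y_inner gram)
    also have "(\<Sum>j\<in>UNIV. (x j)\<^sup>2 * (a\<^sup>2 / 2 * (of_bool (j = i) - 1 / N))) =
        a\<^sup>2 / 2 * (\<Sum>j\<in>UNIV. (x j)\<^sup>2 * of_bool (j = i) - (x j)\<^sup>2 / N)"
      unfolding sum_distrib_left by (intro sum.cong refl) (simp only: right_diff_distrib, simp add: mult.commute)
    also have "(\<Sum>j\<in>UNIV. (x j)\<^sup>2 * of_bool (j = i) - (x j)\<^sup>2 / N) = (x i)\<^sup>2 - s / N"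
      by (simp add: sum_subtractf s_def sum_divide_distrib[symmetric])
    finally show ?thesis
      using edge_pos by simp
  qed
  have simplify: "- (1 / A) * (s\<^sup>2 / (2 * N) - ((A + s)\<^sup>2 / N - A\<^sup>2) / 2) =
      s / N - A / 2 * (1 - 1 / N)" if "A > 0" for A
    using N_pos that by (simp add: field_simps power2_eq_square)
  have "(norm y)\<^sup>2 = - (1 / a\<^sup>2) * (\<Sum>j\<in>UNIV. (x j)\<^sup>2 * ((s / N - (x j)\<^sup>2) / 2))"
    unfolding power2_norm_eq_inner y_inner y_w[unfolded inner_commute[of y]] ..
  also have "(\<Sum>j\<in>UNIV. (x j)\<^sup>2 * ((s / N - (x j)\<^sup>2) / 2)) =
      (\<Sum>j\<in>UNIV. s / (2 * N) * (x j)\<^sup>2 - x j ^ 4 / 2)"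
    by (intro sum.cong refl) (simp add: power2_eq_square power4_eq_xxxx field_simps)
  also have "\<dots> = s\<^sup>2 / (2 * N) - (\<Sum>j\<in>UNIV. x j ^ 4) / 2"
    unfolding sum_subtractf sum_distrib_left[symmetric] sum_divide_distrib[symmetric] s_def[symmetric]
    by (simp add: power2_eq_square)
  also have "(\<Sum>j\<in>UNIV. x j ^ 4) = (a\<^sup>2 + s)\<^sup>2 / N - a ^ 4"
    using form N_pos by (simp add: distance_form_def s_def field_simps)
  finally have norm_y: "(norm y)\<^sup>2 = s / N - a\<^sup>2 / 2 * (1 - 1 / N)"
    using simplify[of "a\<^sup>2"] edge_pos by simp
  have "norm ((1 / N) *\<^sub>R (\<Sum>i\<in>UNIV. v i) + y - v j) = x j" for j
    using norm_diff_vertex[of y j] nonneg[of j] by (simp add: norm_y y_w field_simps)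
  then show ?thesis by blast
qed


section \<open>Changing the sign of one distance by analytic continuation\<close>

text \<open>If the line met \<open>v j\<close>, then \<open>t - v k\<close> would be
  \<open>r\<close> times \<open>v j - v k\<close>, and the squared distances from \<open>t\<close>
  to \<open>v j\<close> and to a third vertex \<open>v i\<close> would differ by
  \<open>a^2 * r\<close>. The bounds force \<open>\<bar>r\<bar> \<le> 1 / 2\<close>, so the squared
  distance to \<open>v j\<close> is at most \<open>9 / 4 * a^2\<close>, below the lower
  bound.\<close>

lemma line_through_vertex_misses_other:
  assumes card: "3 \<le> CARD('k)" and "j \<noteq> k"
    and lower: "\<And>i. i \<noteq> k \<Longrightarrow> 4 * a\<^sup>2 \<le> (norm (t - v i))\<^sup>2"
    and upper: "\<And>i. i \<noteq> k \<Longrightarrow> (norm (t - v i))\<^sup>2 \<le> 4 * a\<^sup>2 + a\<^sup>2 / 2"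
  shows "v k + s *\<^sub>R (t - v k) \<noteq> v j"
proof
  assume eq: "v k + s *\<^sub>R (t - v k) = v j"
  define r where "r = 1 / s"
  have "s \<noteq> 0"
    using eq edge[of k j] edge_pos \<open>j \<noteq> k\<close> by auto
  have "t - v k = r *\<^sub>R (s *\<^sub>R (t - v k))"
    using \<open>s \<noteq> 0\<close> by (simp add: r_def)
  also have "s *\<^sub>R (t - v k) = v j - v k"
    using eq by (simp add: algebra_simps)
  finally have t: "t - v i = r *\<^sub>R (v j - v k) - (v i - v k)" for i
    by (simp add: algebra_simps)
  obtain i where i: "i \<noteq> k" "i \<noteq> j"
  proof -
    have "card {k, j} < CARD('k)"
      using card \<open>j \<noteq> k\<close> by simp
    then have "{k, j} \<noteq> UNIV" by auto
    then show ?thesis using that by auto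
  qed
  have ip: "(v l - v k) \<bullet> (v m - v k) = a\<^sup>2 / 2 * (of_bool (l = m) + 1)" if "l \<noteq> k" "m \<noteq> k" for l m
    using that edge_inner[of l k m k] by simp
  have sq: "(norm (t - v l))\<^sup>2 = a\<^sup>2 * (r\<^sup>2 - r * (of_bool (j = l) + 1) + 1)" if "l \<noteq> k" for l
    unfolding t norm_scaleR_diff_sq ip[OF \<open>j \<noteq> k\<close> \<open>j \<noteq> k\<close>] ip[OF \<open>j \<noteq> k\<close> that] ip[OF that that]
    by (simp add: algebra_simps)
  have i_sq: "(norm (t - v i))\<^sup>2 = a\<^sup>2 * (r\<^sup>2 - r + 1)"
    and j_sq: "(norm (t - v j))\<^sup>2 = a\<^sup>2 * (r\<^sup>2 - 2 * r + 1)"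
    using sq[of i] sq[of j] i \<open>j \<noteq> k\<close> by auto
  have a2: "a\<^sup>2 > 0"
    using edge_pos by simp
  have "a\<^sup>2 * \<bar>r\<bar> \<le> a\<^sup>2 * (1 / 2)"
    using lower[of i] upper[of i] lower[of j] upper[of j] i \<open>j \<noteq> k\<close>
    unfolding i_sq j_sq by (simp add: abs_if algebra_simps)
  then have "\<bar>r\<bar> \<le> 1 / 2"
    using a2 mult_le_cancel_left_pos by blast
  moreover have "a\<^sup>2 * 4 \<le> a\<^sup>2 * (r\<^sup>2 - 2 * r + 1)"
    using lower[of j] \<open>j \<noteq> k\<close> unfolding j_sq by simp
  then have "4 \<le> r\<^sup>2 - 2 * r + 1"
    using a2 mult_le_cancel_left_pos by blast
  moreover have "r\<^sup>2 \<le> (1 / 2)\<^sup>2"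
    using calculation(1) power2_le_iff_abs_le[of "1 / 2" r] by simp
  ultimately show False
    by (simp add: power2_eq_square abs_if split: if_splits)
qed

lemma distance_form_upd:
  fixes x :: "'k \<Rightarrow> real" and k :: 'k
  defines "B \<equiv> a\<^sup>2 + (\<Sum>j\<in>UNIV - {k}. (x j)\<^sup>2)"
  shows "distance_form (x(k := y)) = (N - 1) * (y\<^sup>2)\<^sup>2 - 2 * B * y\<^sup>2 +
    (N * (a ^ 4 + (\<Sum>j\<in>UNIV - {k}. x j ^ 4)) - B\<^sup>2)"
proof -
  have "(\<Sum>j\<in>UNIV. (x(k := y)) j ^ e) = y ^ e + (\<Sum>j\<in>UNIV - {k}. x j ^ e)" for e
    by (subst sum.remove[of UNIV k]) auto
  then show ?thesis
    unfolding distance_form_def B_def by (simp only:) (simp add: power2_eq_square power4_eq_xxxx algebra_simps)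
qed

text \<open>On the line \<open>v k + s u\<close> the distance to \<open>v k\<close> equals
  \<open>- norm u * s\<close> for \<open>s < 0\<close>. Keeping this expression for all
  \<open>s\<close> makes the value of \<open>f\<close> holomorphic in \<open>s\<close> near the real
  axis. It vanishes for \<open>s < 0\<close>, hence also at \<open>s = 1\<close>, where the
  coordinate is \<open>- norm u\<close>.\<close>

lemma reflect_distance:
  assumes vanish: "\<And>t. mpoly_eval (\<lambda>j. norm (t - v j)) f = 0"
    and "t \<noteq> v k" and misses: "\<And>j s. j \<noteq> k \<Longrightarrow> v k + s *\<^sub>R (t - v k) \<noteq> v j"
  shows "mpoly_eval ((\<lambda>j. norm (t - v j))(k := - norm (t - v k))) f = 0"
proof -
  define u where "u = t - v k"
  define \<alpha> where "\<alpha> = u \<bullet> u"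
  define \<beta> where "\<beta> j = u \<bullet> (v j - v k)" for j
  define \<gamma> where "\<gamma> j = (v j - v k) \<bullet> (v j - v k)" for j
  define \<delta> where "\<delta> j = \<alpha> * \<gamma> j - (\<beta> j)\<^sup>2" for j
  \<comment> \<open>The roots of \<open>Q j\<close> are
    \<open>(\<beta> j \<plusminus> \<i> * sqrt (\<delta> j)) / \<alpha>\<close>, so the strip
    \<open>S\<close> stays strictly between them for every \<open>j\<close> other than
    \<open>k\<close>.\<close>
  define c where "c j = sqrt (\<delta> j) / \<alpha>" for j
  define S where "S = (\<Inter>j\<in>UNIV - {k}. {z. - c j < Im z} \<inter> {z. Im z < c j})"
  define Q where "Q j z = of_real \<alpha> * z\<^sup>2 - of_real (2 * \<beta> j) * z + of_real (\<gamma> j)" for j and z :: complex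
  define h where "h j z = (if j = k then - of_real (norm u) * z else csqrt (Q j z))" for j z
  define g where "g z = (\<Sum>m\<in>Poly_Mapping.keys f. of_real (Poly_Mapping.lookup f m) *
      (\<Prod>j\<in>UNIV. h j z ^ Poly_Mapping.lookup m j))" for z
  have \<alpha>: "\<alpha> > 0"
    using \<open>t \<noteq> v k\<close> by (simp add: \<alpha>_def u_def)
  have sq: "(norm (v k + s *\<^sub>R u - v j))\<^sup>2 = \<alpha> * s\<^sup>2 - 2 * \<beta> j * s + \<gamma> j" for j s
  proof -
    have "v k + s *\<^sub>R u - v j = s *\<^sub>R u - (v j - v k)" by simp
    then show ?thesis
      by (simp only: norm_scaleR_diff_sq \<alpha>_def \<beta>_def \<gamma>_def) (simp add: mult_ac)
  qed
  have \<delta>: "\<delta> j > 0" if "j \<noteq> k" for j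
  proof -
    \<comment> \<open>The parameter \<open>\<beta> j / \<alpha>\<close> is the foot of the
      perpendicular from \<open>v j\<close> to the line.\<close>
    have "0 < (norm (v k + (\<beta> j / \<alpha>) *\<^sub>R u - v j))\<^sup>2"
      using misses[OF that, of "\<beta> j / \<alpha>"] by (simp add: u_def)
    also have "\<dots> = \<delta> j / \<alpha>"
      unfolding sq \<delta>_def using \<alpha> by (simp add: field_simps power2_eq_square)
    finally show ?thesis using \<alpha> by (simp add: zero_less_divide_iff)
  qed
  have c: "c j > 0" if "j \<noteq> k" for j
    using \<delta>[OF that] \<alpha> by (simp add: c_def)
  have S: "open S" "connected S"
    unfolding S_def
    by (intro open_INT ballI open_Int open_halfspace_Im_gt open_halfspace_Im_lt finite)
      (intro convex_connected convex_INT convex_Int convex_halfspace_Im_gt convex_halfspace_Im_lt)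
  have real_in_S: "of_real s \<in> S" for s
    using c by (auto simp: S_def)
  have Q: "Q j z \<notin> \<real>\<^sub>\<le>\<^sub>0" if "z \<in> S" "j \<noteq> k" for j z
  proof -
    have "\<bar>Im z\<bar> < c j"
      using that by (force simp: S_def)
    then have "\<bar>\<alpha> * Im z\<bar> < sqrt (\<delta> j)"
      using \<alpha> by (simp add: c_def abs_mult field_simps)
    then have "(\<alpha> * Im z)\<^sup>2 < \<delta> j"
      using real_sqrt_less_iff[of "(\<alpha> * Im z)\<^sup>2" "\<delta> j"] by simp
    \<comment> \<open>Completing the square shows that \<open>Q j\<close> has positive real part on
      the strip, away from the branch cut of \<open>csqrt\<close>.\<close>
    moreover have "\<alpha> * Re (Q j z) = (\<alpha> * Re z - \<beta> j)\<^sup>2 + \<delta> j - (\<alpha> * Im z)\<^sup>2"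
      by (simp add: Q_def \<delta>_def power2_eq_square algebra_simps)
    ultimately have "\<alpha> * Re (Q j z) > 0"
      by (smt (verit) zero_le_power2)
    then show ?thesis
      using \<alpha> by (auto simp: zero_less_mult_iff complex_nonpos_Reals_iff)
  qed
  have h_holo: "h j holomorphic_on S" for j
  proof (cases "j = k")
    case True
    then show ?thesis
      unfolding h_def by (simp add: holomorphic_intros)
  next
    case False
    have "(\<lambda>z. csqrt (Q j z)) holomorphic_on S"
      by (rule holomorphic_on_csqrt') (use Q[OF _ False] in \<open>auto simp: Q_def intro!: holomorphic_intros\<close>)
    with False show ?thesis
      unfolding h_def by simp
  qed
  have g_holo: "g holomorphic_on S"
    unfolding g_def by (intro holomorphic_intros h_holo)
  have g_real: "g (of_real s) = of_real (mpoly_eval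
      (\<lambda>j. if j = k then - norm u * s else norm (v k + s *\<^sub>R u - v j)) f)" for s
  proof -
    have "csqrt (Q j (of_real s)) = of_real (norm (v k + s *\<^sub>R u - v j))" for j
    proof -
      have "Q j (of_real s) = of_real ((norm (v k + s *\<^sub>R u - v j))\<^sup>2)"
        unfolding sq Q_def by simp
      then show ?thesis
        using of_real_sqrt[of "(norm (v k + s *\<^sub>R u - v j))\<^sup>2"] by simp
    qed
    then have "h j (of_real s) =
        of_real (if j = k then - norm u * s else norm (v k + s *\<^sub>R u - v j))" for j
      by (simp add: h_def)
    then show ?thesis
      by (simp only: g_def mpoly_eval_def of_real_sum of_real_mult of_real_prod of_real_power)
  qed
  have "g 1 = 0"
  proof (rule analytic_continuation[OF g_holo S])
    show "of_real ` {..<0} \<subseteq> S"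
      using real_in_S by auto
    show "0 \<in> S" "1 \<in> S"
      using real_in_S[of 0] real_in_S[of 1] by simp_all
    show "0 islimpt (complex_of_real ` {..<0})"
      unfolding islimpt_approachable
    proof (intro allI impI)
      fix e :: real assume "e > 0"
      then show "\<exists>z\<in>complex_of_real ` {..<0}. z \<noteq> 0 \<and> dist z 0 < e"
        by (intro bexI[of _ "of_real (- e / 2)"]) (auto simp: dist_norm norm_of_real simp del: of_real_minus of_real_divide)
    qed
  next
    fix z :: complex assume "z \<in> of_real ` {..<0}"
    then obtain s where s: "z = of_real s" "s < 0" by auto
    have "(\<lambda>j. if j = k then - norm u * s else norm (v k + s *\<^sub>R u - v j)) =
        (\<lambda>j. norm (v k + s *\<^sub>R u - v j))"
      using s by auto
    then show "g z = 0"
      unfolding s(1) g_real by (simp only: vanish of_real_0)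
  qed
  moreover have "(\<lambda>j. if j = k then - norm u * 1 else norm (v k + 1 *\<^sub>R u - v j)) =
      (\<lambda>j. norm (t - v j))(k := - norm (t - v k))"
    by (auto simp: u_def)
  ultimately show ?thesis
    using g_real[of 1] by simp
qed

end

section \<open>The ideal of relations\<close>

lemma quadratic_two_positive_roots:
  fixes n B C :: real
  assumes "n > 0" "B > 0" "C > 0" "n * C < B\<^sup>2"
  obtains X Y where "0 < X" "X < Y" "n * X\<^sup>2 - 2 * B * X + C = 0" "n * Y\<^sup>2 - 2 * B * Y + C = 0"
proof
  define D where "D = sqrt (B\<^sup>2 - n * C)"
  have D: "D > 0" "D\<^sup>2 = B\<^sup>2 - n * C"
    using assms by (auto simp: D_def)
  have "D\<^sup>2 < B\<^sup>2"
    using assms D by simp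
  then have "D < B"
    using assms(2) power2_less_imp_less by fastforce
  show "0 < (B - D) / n" "(B - D) / n < (B + D) / n"
    using \<open>D < B\<close> D assms by (auto intro: divide_strict_right_mono)
  have "n * (E / n)\<^sup>2 - 2 * B * (E / n) + C = ((E - B)\<^sup>2 - (B\<^sup>2 - n * C)) / n" for E
    using assms(1) by (simp add: field_simps power2_eq_square)
  from this[of "B - D"] this[of "B + D"]
  show "n * ((B - D) / n)\<^sup>2 - 2 * B * ((B - D) / n) + C = 0"
    "n * ((B + D) / n)\<^sup>2 - 2 * B * ((B + D) / n) + C = 0"
    by (simp_all add: D(2))
qed

text \<open>
  \<open>C\<close> and \<open>B\<^sup>2 - n C\<close> control the coefficients of the distance form as a quadratic in the square of
  one variable; the values \<open>s j\<close> of the other squares lie just above \<open>4 A\<close>.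
\<close>
lemma box_estimates:
  fixes s :: "'k \<Rightarrow> real"
  assumes "finite J" "J \<noteq> {}" "A > 0"
  defines "n \<equiv> real (card J)"
  assumes lower: "\<And>j. j \<in> J \<Longrightarrow> 4 * A \<le> s j"
    and upper: "\<And>j. j \<in> J \<Longrightarrow> s j \<le> 4 * A + A / n"
  defines "B \<equiv> A + (\<Sum>j\<in>J. s j)"
  defines "C \<equiv> (n + 1) * (A\<^sup>2 + (\<Sum>j\<in>J. (s j)\<^sup>2)) - B\<^sup>2"
  shows "B > 0" "C > 0" "n * C < B\<^sup>2"
proof -
  define \<sigma> where "\<sigma> = (\<Sum>j\<in>J. s j)"
  define q where "q = (\<Sum>j\<in>J. (s j)\<^sup>2)"
  define e where "e j = s j - 4 * A" for j
  have n: "n \<ge> 1"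
    using assms(1,2) by (simp add: n_def Suc_le_eq card_gt_0_iff)
  have \<sigma>: "\<sigma> \<ge> 4 * A * n"
    using sum_mono[of J "\<lambda>_. 4 * A" s] lower by (simp add: \<sigma>_def n_def mult_ac)
  have q: "q \<ge> 4 * A * \<sigma>"
    unfolding q_def \<sigma>_def sum_distrib_left power2_eq_square
    using lower \<open>A > 0\<close> by (intro sum_mono mult_right_mono) (fastforce+)
  have cauchy: "\<sigma>\<^sup>2 \<le> n * q"
    using sum_squared_le_sum_of_squares[of s J] by (simp add: \<sigma>_def q_def n_def mult_ac)
  \<comment> \<open>The left side is \<open>n^2\<close> times the variance of the
    \<open>s j\<close>, so it does not change when \<open>4 * A\<close> is subtracted from each; the
    shifted values lie between 0 and \<open>A / n\<close>.\<close>
  have spread: "n * q - \<sigma>\<^sup>2 \<le> A\<^sup>2"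
  proof -
    have s_e: "\<sigma> = (\<Sum>j\<in>J. e j) + 4 * A * n"
      by (simp add: \<sigma>_def e_def n_def sum_subtractf)
    have "q = (\<Sum>j\<in>J. (e j)\<^sup>2 + 8 * A * e j + 16 * A\<^sup>2)"
      unfolding q_def by (intro sum.cong refl) (simp add: e_def power2_eq_square algebra_simps)
    then have "q = (\<Sum>j\<in>J. (e j)\<^sup>2) + 8 * A * (\<Sum>j\<in>J. e j) + 16 * A\<^sup>2 * n"
      by (simp add: sum.distrib sum_distrib_left n_def)
    then have "n * q - \<sigma>\<^sup>2 = n * (\<Sum>j\<in>J. (e j)\<^sup>2) - (\<Sum>j\<in>J. e j)\<^sup>2"
      unfolding s_e by (simp add: power2_eq_square algebra_simps)
    also have "\<dots> \<le> n * (\<Sum>j\<in>J. (e j)\<^sup>2)"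
      by simp
    also have "\<dots> \<le> n * (\<Sum>j\<in>J. (A / n)\<^sup>2)"
      using n lower upper by (intro mult_left_mono sum_mono power_mono) (auto simp: e_def algebra_simps)
    also have "\<dots> = A\<^sup>2"
      using n by (simp add: n_def[symmetric] power2_eq_square)
    finally show ?thesis .
  qed
  have An: "A * A * n \<ge> A * A * 1"
    using n \<open>A > 0\<close> by (intro mult_left_mono) auto
  have A\<sigma>: "A * \<sigma> \<ge> A * (4 * A * n)"
    using \<sigma> \<open>A > 0\<close> by (intro mult_left_mono) auto
  have AA: "A * A > 0"
    using \<open>A > 0\<close> by simp
  have "\<sigma> > 0"
    using \<sigma> n \<open>A > 0\<close> by (smt (verit) mult_pos_pos)
  then show "B > 0"
    using \<open>A > 0\<close> by (simp add: B_def \<sigma>_def)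
  have C: "C = (n + 1) * (A\<^sup>2 + q) - (A + \<sigma>)\<^sup>2"
    by (simp add: C_def B_def \<sigma>_def q_def)
  have "C = n * (A * A) + (n * q - \<sigma>\<^sup>2) + (q - 4 * A * \<sigma>) + 2 * (A * \<sigma>)"
    unfolding C by (simp add: power2_eq_square algebra_simps)
  then show "C > 0"
    using cauchy q A\<sigma> An AA by (simp add: mult_ac)
  \<comment> \<open>In the second factor, \<open>2 * (A * \<sigma>)\<close> is at least
    \<open>8 * n * A^2\<close>, which outweighs both negative terms.\<close>
  have "B\<^sup>2 - n * C = (n + 1) * (A * A + 2 * (A * \<sigma>) - n * (A * A) - (n * q - \<sigma>\<^sup>2))"
    unfolding C by (simp add: B_def \<sigma>_def[symmetric] power2_eq_square algebra_simps)
  also have "\<dots> > 0"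
    using n spread A\<sigma> An AA by (intro mult_pos_pos) (auto simp: power2_eq_square mult_ac)
  finally show "n * C < B\<^sup>2" by simp
qed

context equidistant_points
begin

text \<open>The form is a quadratic in the square of the coordinate \<open>k\<close>.
  \<open>box_estimates\<close> with \<open>A = a^2\<close> gives this quadratic two positive roots,
  and \<open>X\<close>, \<open>Y\<close> are their square roots.\<close>

lemma distance_form_two_positive_roots:
  assumes "CARD('k) \<ge> 2"
    and lower: "\<And>j. 4 * a\<^sup>2 \<le> (x j)\<^sup>2" and upper: "\<And>j. (x j)\<^sup>2 \<le> 4 * a\<^sup>2 + a\<^sup>2 / (N - 1)"
  obtains X Y where "0 < X" "X < Y" "distance_form (x(k := X)) = 0" "distance_form (x(k := Y)) = 0"
proof -
  define B where "B = a\<^sup>2 + (\<Sum>j\<in>UNIV - {k}. (x j)\<^sup>2)"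
  define C where "C = N * (a ^ 4 + (\<Sum>j\<in>UNIV - {k}. x j ^ 4)) - B\<^sup>2"
  have card: "real (card (UNIV - {k})) = N - 1"
    using assms(1) card_vertices by (simp add: card_Diff_singleton of_nat_diff del: card_vertices)
  have "UNIV - {k} \<noteq> {}"
    using assms(1) card card_vertices by (intro notI) (simp del: card_vertices)
  then have "B > 0" "C > 0" "(N - 1) * C < B\<^sup>2"
    using box_estimates[of "UNIV - {k}" "a\<^sup>2" "\<lambda>j. (x j)\<^sup>2"] lower upper edge_pos
    by (auto simp: card B_def C_def)
  moreover have "N - 1 > 0"
    using assms(1) card_vertices by linarith
  ultimately obtain X Y where XY: "0 < X" "X < Y"
    "(N - 1) * X\<^sup>2 - 2 * B * X + C = 0" "(N - 1) * Y\<^sup>2 - 2 * B * Y + C = 0"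
    using quadratic_two_positive_roots by metis
  have "distance_form (x(k := sqrt Z)) = (N - 1) * Z\<^sup>2 - 2 * B * Z + C" if "Z > 0" for Z
    using that by (simp add: distance_form_upd B_def C_def)
  with XY show ?thesis
    by (intro that[of "sqrt X" "sqrt Y"]) auto
qed

section \<open>Reduced relations are zero\<close>

lemma vanishing_both_signs:
  assumes card: "3 \<le> CARD('k)" and vanish: "\<And>t. mpoly_eval (\<lambda>j. norm (t - v j)) f = 0"
    and pos: "\<And>j. 0 < x j" and form: "distance_form x = 0"
    and lower: "\<And>j. j \<noteq> k \<Longrightarrow> 4 * a\<^sup>2 \<le> (x j)\<^sup>2"
    and upper: "\<And>j. j \<noteq> k \<Longrightarrow> (x j)\<^sup>2 \<le> 4 * a\<^sup>2 + a\<^sup>2 / 2"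
  shows "mpoly_eval x f = 0" "mpoly_eval (x(k := - x k)) f = 0"
proof -
  obtain t where t: "\<And>j. norm (t - v j) = x j"
    using exists_point_with_distances[of x] pos form less_imp_le by metis
  show "mpoly_eval x f = 0"
    using vanish[of t] by (simp add: t)
  have "t \<noteq> v k"
    using t[of k] pos[of k] by auto
  then have "mpoly_eval ((\<lambda>j. norm (t - v j))(k := - norm (t - v k))) f = 0"
    using line_through_vertex_misses_other[OF card, of _ k t] lower upper
    by (intro reflect_distance vanish) (auto simp: t)
  then show "mpoly_eval (x(k := - x k)) f = 0"
    by (simp add: t)
qed

lemma vanishing_low_degree_eq_0:
  fixes r :: "('k, real) mpoly"
  assumes card: "3 \<le> CARD('k)" and vanish: "\<And>t. mpoly_eval (\<lambda>j. norm (t - v j)) r = 0"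
    and deg: "degree_in_le k 3 r"
  shows "r = 0"
\<comment> \<open>The upper end is the bound that produces two positive roots. Since
  \<open>N \<ge> 3\<close>, it also implies the bound with \<open>a^2 / 2\<close> under which the
  line misses the other vertices.\<close>
proof (rule mpoly_zero_of_many_roots[OF deg, of "\<lambda>_. {2 * a..sqrt (4 * a\<^sup>2 + a\<^sup>2 / (N - 1))}"])
  have N: "N \<ge> 3"
    using card card_vertices by linarith
  have "2 * a = sqrt (4 * a\<^sup>2)"
    using edge_pos by (simp add: real_sqrt_mult)
  also have "\<dots> < sqrt (4 * a\<^sup>2 + a\<^sup>2 / (N - 1))"
    using edge_pos N by simp
  finally show "infinite {2 * a..sqrt (4 * a\<^sup>2 + a\<^sup>2 / (N - 1))}"
    by (simp add: infinite_Icc)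
  fix x :: "'k \<Rightarrow> real"
  assume x: "\<And>j. x j \<in> {2 * a..sqrt (4 * a\<^sup>2 + a\<^sup>2 / (N - 1))}"
  have pos: "x j > 0" for j
    using x[of j] edge_pos by auto
  have lower: "4 * a\<^sup>2 \<le> (x j)\<^sup>2" for j
    using x[of j] edge_pos power_mono[of "2 * a" "x j" 2] by simp
  have upper: "(x j)\<^sup>2 \<le> 4 * a\<^sup>2 + a\<^sup>2 / (N - 1)" for j
    using x[of j] pos[of j] N real_le_rsqrt[of "x j"] sqrt_ge_absD[of "x j"] by auto
  have "a\<^sup>2 / (N - 1) \<le> a\<^sup>2 / 2"
    using N by (intro divide_left_mono) auto
  then have upper': "(x j)\<^sup>2 \<le> 4 * a\<^sup>2 + a\<^sup>2 / 2" for j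
    using upper[of j] by linarith
  obtain X Y where XY: "0 < X" "X < Y" "distance_form (x(k := X)) = 0" "distance_form (x(k := Y)) = 0"
    using distance_form_two_positive_roots[of x k] card lower upper by auto
  have roots: "mpoly_eval (x(k := Z)) r = 0 \<and> mpoly_eval (x(k := - Z)) r = 0"
    if "Z > 0" "distance_form (x(k := Z)) = 0" for Z
    using vanishing_both_signs[OF card vanish, of "x(k := Z)" k] that pos lower upper' by auto
  have "card {X, - X, Y, - Y} = 4"
    using XY(1,2) by simp
  then show "\<exists>B. (infinite B \<or> 3 < card B) \<and> (\<forall>t\<in>B. mpoly_eval (x(k := t)) r = 0)"
    using roots[of X] roots[of Y] XY by (intro exI[of _ "{X, - X, Y, - Y}"]) auto
qed

end

text \<open>The fourth power of variable \<open>k\<close> occurs \<open>d + 1\<close> times in the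
  first summand and once in the square, which leaves the coefficient \<open>d\<close>; the cross
  term has degree 2 in that variable.\<close>

lemma distance_polynomial_split:
  fixes a :: real and d :: nat and k :: "'k::finite"
  defines "F \<equiv> of_nat (Suc d) * (mpoly_const (a ^ 4) + (\<Sum>j\<in>UNIV. mpoly_var j ^ 4))
               - (mpoly_const (a ^ 2) + (\<Sum>j\<in>UNIV. mpoly_var j ^ 2)) ^ 2"
  shows "\<exists>G. degree_in_le k 3 G \<and>
    F = mpoly_const (real d) * (mpoly_var k :: ('k, real) mpoly) ^ 4 + G"
proof -
  define T where "T = (mpoly_var k :: ('k, real) mpoly)"
  define E where "E e = (\<Sum>j\<in>UNIV - {k}. (mpoly_var j :: ('k, real) mpoly) ^ e)" for e
  define G where "G = mpoly_const (real (Suc d)) * (mpoly_const (a ^ 4) + E 4)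
    - (mpoly_const 2 * T ^ 2 * (mpoly_const (a ^ 2) + E 2) + (mpoly_const (a ^ 2) + E 2) ^ 2)"
  have split: "(\<Sum>j\<in>UNIV. mpoly_var j ^ e) = T ^ e + E e" for e
    by (simp add: T_def E_def sum.remove[of UNIV k])
  have "mpoly_const 2 = (2 :: ('k, real) mpoly)"
    using mpoly_const_of_nat[of 2] by simp
  then have "F = mpoly_const (real d) * T ^ 4 + G"
    unfolding F_def G_def split mpoly_const_of_nat
    by (simp add: power2_eq_square power4_eq_xxxx algebra_simps)
  moreover have "degree_in_le k 3 G"
  proof -
    have E: "degree_in_le k 0 (E e)" for e
      unfolding E_def using degree_in_le_power[OF degree_in_le_other_var, of _ k e]
      by (intro degree_in_le_sum) auto
    have b: "degree_in_le k 0 (mpoly_const c + E e)" for c e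
      by (intro degree_in_le_add degree_in_le_const E)
    have "degree_in_le k (0 + 0) (mpoly_const (real (Suc d)) * (mpoly_const (a ^ 4) + E 4))"
      by (intro degree_in_le_mult degree_in_le_const b)
    moreover have "degree_in_le k (0 + 2 * 1 + 0) (mpoly_const 2 * T ^ 2 * (mpoly_const (a ^ 2) + E 2))"
      unfolding T_def
      by (intro degree_in_le_mult degree_in_le_power degree_in_le_var degree_in_le_const b)
    moreover have "degree_in_le k (2 * 0) ((mpoly_const (a ^ 2) + E 2) ^ 2)"
      by (intro degree_in_le_power b)
    ultimately show ?thesis
      unfolding G_def by (intro degree_in_le_diff degree_in_le_add) (auto elim: degree_in_le_mono)
  qed
  ultimately show ?thesis
    unfolding T_def by blast
qed

theorem theorem5p1:
  fixes d :: nat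
    and a :: real
    and v :: "'k::finite \<Rightarrow> real ^ 'n"
    and S :: "(real ^ 'n) set"
    and I :: "('k, real) mpoly set"
    and F :: "('k, real) mpoly"
  assumes "d \<ge> 2"
    and "CARD('n) = d"
    and "CARD('k) = d + 1"
    and "regular_simplex a v S"
    and "I = {f. \<forall>t :: real ^ 'n. mpoly_eval (\<lambda>j. norm (t - v j)) f = 0}"
    and "F = of_nat (d + 1) * (mpoly_const (a ^ 4) + (\<Sum>j\<in>UNIV. mpoly_var j ^ 4))
               - (mpoly_const (a ^ 2) + (\<Sum>j\<in>UNIV. mpoly_var j ^ 2)) ^ 2"
  shows "I = principal_ideal F"
proof -
  interpret equidistant_points v a "real CARD('k)"
    using assms(4) by unfold_locales (auto simp: regular_simplex_def)
  have "mpoly_eval x F = distance_form x" for x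
    unfolding assms(6) distance_form_def unfolding assms(3) by simp
  then have F: "mpoly_eval (\<lambda>j. norm (t - v j)) F = 0" for t
    using distance_form_vanishes[of t] assms(2,3) by simp
  obtain k :: 'k where True by simp
  obtain G where G: "degree_in_le k 3 G"
    and F_eq: "F = mpoly_const (real d) * mpoly_var k ^ Suc 3 + G"
    using distance_polynomial_split[of k d a] unfolding assms(6) by (auto simp: eval_nat_numeral)
  show ?thesis
  proof (intro set_eqI iffI)
    fix f assume "f \<in> I"
    \<comment> \<open>Division is possible because the leading coefficient \<open>d\<close> is
      nonzero; the remainder is again a relation, as \<open>F\<close> is one.\<close>
    obtain q r where f: "f = q * F + r" and r: "degree_in_le k 3 r"
      using mpoly_division_in_variable[OF G, of "real d" f] assms(1) unfolding F_eq by auto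
    have "mpoly_eval (\<lambda>j. norm (t - v j)) r = 0" for t
      using \<open>f \<in> I\<close> by (simp add: assms(5) f F)
    then have "r = 0"
      using vanishing_low_degree_eq_0[OF _ _ r] assms(1,3) by simp
    with f show "f \<in> principal_ideal F"
      by (auto simp: principal_ideal_def)
  next
    fix f assume "f \<in> principal_ideal F"
    then show "f \<in> I"
      by (auto simp: principal_ideal_def assms(5) F)
  qed
qed

end
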